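(* Let $\alpha\in(0,\pi)$ and let $n\geq 1$ be an integer. The function system $T_{2n}^{\alpha}$ of constrained trivariate functions on $\Omega^{\alpha}$ is linearly independent (over $\mathbb{R}$), and the dimension of the vector space $\mathcal{T}_{2n}^{\alpha}=\operatorname{span} T_{2n}^{\alpha}$ is $$\delta_{n}=3n(n+1)+1.$$
   Context: For $\alpha\in(0,\pi)$ let $\Omega^{\alpha}=\{(u,v,w)\in[0,\alpha]^3: u+v+w=\alpha\}$. All functions below are real-valued functions of $(u,v,w)\in\Omega^{\alpha}$. For an integer $n\ge 1$, $0\le j\le n$ and $j\le i\le 2n-j$, define $$R_{2n,2n-i,j}^{\alpha}(u,v,w)=\begin{cases}\sin^{2n-i}\frac{u}{2}\,\sin^{i}\frac{w}{2}\,\cos^{i-j}\frac{v}{2}\,\sin^{j}\frac{v}{2}, & j\le i\le n,\\[4pt] \sin^{2n-i}\frac{u}{2}\,\sin^{i}\frac{w}{2}\,\cos^{2n-i-j}\frac{v}{2}\,\sin^{j}\frac{v}{2}, & n+1\le i\le 2n-j,\end{cases}$$ and, by cyclic permutation of the variables, $$G_{2n,2n-i,j}^{\alpha}(u,v,w)=R_{2n,2n-i,j}^{\alpha}(w,u,v),\qquad B_{2n,2n-i,j}^{\alpha}(u,v,w)=R_{2n,2n-i,j}^{\alpha}(v,w,u).$$ Note that $R_{2n,n,n}^{\alpha}=G_{2n,n,n}^{\alpha}=B_{2n,n,n}^{\alpha}=\sin^n\frac{u}{2}\sin^n\frac{v}{2}\sin^n\frac{w}{2}$. The joint function system of order $n$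 is $$T_{2n}^{\alpha}=\left\{R_{2n,2n-i,j}^{\alpha},\ G_{2n,2n-i,j}^{\alpha},\ B_{2n,2n-i,j}^{\alpha}\ :\ 0\le j\le n-1,\ j\le i\le 2n-1-j\right\}\cup\left\{R_{2n,n,n}^{\alpha}\right\},$$ regarded as a family indexed by the letter ($R$, $G$ or $B$) and the pair $(i,j)$, together with the single function $R_{2n,n,n}^{\alpha}$. *)

theory Defs
  imports "HOL-Analysis.Analysis" "HOL-Library.Function_Algebras"
begin

text \<open>
  The pointwise real vector space structure on functions, so that the library notions
  \<open>independent\<close>, \<open>span\<close> and \<open>dim\<close> apply to sets of real-valued functions.
\<close>

instantiation "fun" :: (type, real_vector) real_vector
begin

definition scaleR_fun :: "real \<Rightarrow> ('a \<Rightarrow> 'b) \<Rightarrow> 'a \<Rightarrow> 'b" where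
  "scaleR_fun c f = (\<lambda>x. c *\<^sub>R f x)"

instance
  by standard (simp_all add: scaleR_fun_def fun_eq_iff scaleR_add_right scaleR_add_left)

end

definition Omega :: "real \<Rightarrow> (real \<times> real \<times> real) set" where
  "Omega \<alpha> = {(u, v, w). u \<in> {0..\<alpha>} \<and> v \<in> {0..\<alpha>} \<and> w \<in> {0..\<alpha>} \<and> u + v + w = \<alpha>}"

text \<open>
  A real-valued function on \<open>Omega \<alpha>\<close> is represented by its extension by zero to all triples.
  This identifies the vector space of all functions on \<open>Omega \<alpha>\<close> with the subspace of the
  functions vanishing outside \<open>Omega \<alpha>\<close>; in particular, linear combinations are compared only
  on \<open>Omega \<alpha>\<close>.
\<close>

definition on_Omega :: "real \<Rightarrow> (real \<Rightarrow> real \<Rightarrow> real \<Rightarrow> real) \<Rightarrow> real \<times> real \<times> real \<Rightarrow> real" where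
  "on_Omega \<alpha> f = (\<lambda>(u, v, w). if (u, v, w) \<in> Omega \<alpha> then f u v w else 0)"

text \<open>
  \<open>R_expr n i j\<close> is the expression for $R_{2n,2n-i,j}$, meant for \<open>j \<le> n\<close> and
  \<open>j \<le> i \<le> 2 * n - j\<close>, where no subtraction is truncated.
\<close>

definition R_expr :: "nat \<Rightarrow> nat \<Rightarrow> nat \<Rightarrow> real \<Rightarrow> real \<Rightarrow> real \<Rightarrow> real" where
  "R_expr n i j u v w =
     (if i \<le> n
      then sin (u / 2) ^ (2 * n - i) * sin (w / 2) ^ i * cos (v / 2) ^ (i - j) * sin (v / 2) ^ j
      else sin (u / 2) ^ (2 * n - i) * sin (w / 2) ^ i * cos (v / 2) ^ (2 * n - i - j) * sin (v / 2) ^ j)"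

datatype letter = R | G | B

fun joint_fun :: "real \<Rightarrow> nat \<Rightarrow> letter \<times> nat \<times> nat \<Rightarrow> real \<times> real \<times> real \<Rightarrow> real" where
  "joint_fun \<alpha> n (R, i, j) = on_Omega \<alpha> (\<lambda>u v w. R_expr n i j u v w)"
| "joint_fun \<alpha> n (G, i, j) = on_Omega \<alpha> (\<lambda>u v w. R_expr n i j w u v)"
| "joint_fun \<alpha> n (B, i, j) = on_Omega \<alpha> (\<lambda>u v w. R_expr n i j v w u)"

text \<open>
  The joint system is the family \<open>joint_fun \<alpha> n\<close> over this index set; \<open>(R, n, n)\<close> is the
  index of the single function $R_{2n,n,n} = G_{2n,n,n} = B_{2n,n,n}$.
\<close>

definition joint_index :: "nat \<Rightarrow> (letter \<times> nat \<times> nat) set" where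
  "joint_index n =
     {(l, i, j) | l i j. j < n \<and> j \<le> i \<and> i \<le> 2 * n - 1 - j} \<union> {(R, n, n)}"

definition joint_system :: "real \<Rightarrow> nat \<Rightarrow> (real \<times> real \<times> real \<Rightarrow> real) set" where
  "joint_system \<alpha> n = joint_fun \<alpha> n ` joint_index n"

text \<open>
  Linear independence of a family: a repeated member makes the family dependent, which
  \<open>independent\<close> applied to the image set alone does not detect.
\<close>

definition independent_family :: "('i \<Rightarrow> 'v::real_vector) \<Rightarrow> 'i set \<Rightarrow> bool" where
  "independent_family f I \<longleftrightarrow> inj_on f I \<and> independent (f ` I)"

end

theory Submission
  imports Defs
begin

text \<open>
  Every member of the system of order \<open>n\<close> with index \<open>(i, j)\<close>, \<open>j \<ge> 1\<close>, is the product of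
  \<open>sin (u/2) sin (v/2) sin (w/2)\<close> and the member of the system of order \<open>n - 1\<close> with the same
  letter and index \<open>(i - 1, j - 1)\<close>; so independence is proved by induction on \<open>n\<close>, once the
  coefficients of the members with \<open>j = 0\<close> in a vanishing linear combination are known to be zero.

  Those coefficients are read off on the edges of the triangle. On the edge \<open>v = 0\<close> every
  factor \<open>sin (v/2)\<close> vanishes, so the only surviving members are \<open>R\<close> with \<open>j = 0\<close>, which become
  \<open>sin (u/2) ^ (2n-i) * sin (w/2) ^ i\<close> with \<open>i < 2n\<close>, and the member \<open>(G, 0, 0)\<close>, which becomes
  \<open>sin (w/2) ^ 2n\<close>. On this edge \<open>w = \<alpha> - u\<close>, and division by \<open>sin (u/2) ^ 2n\<close> turns
  the combination into a polynomial in \<open>sin ((\<alpha> - u)/2) / sin (u/2)\<close>, a function of \<open>u\<close>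
  with infinitely many values (\<open>binary_form_on_edge_zero\<close>, \<open>edge_coefficients_zero\<close>). The other
  two edges follow from the cyclic symmetry.

  Dividing by the product of the three sines is possible only in the interior of the triangle.
  The induction (\<open>coefficients_zero\<close>) therefore assumes that the combination vanishes on the open
  triangle, and the edges are reached by continuity.

  The dimension is the number of indices, which is counted by peeling off the layer \<open>j = 0\<close> in
  the same way.
\<close>

section \<open>The triangle of indices\<close>

definition index_triangle :: "nat \<Rightarrow> (nat \<times> nat) set" where
  "index_triangle n = {(i, j). j < n \<and> j \<le> i \<and> i \<le> 2 * n - 1 - j}"

lemma finite_index_triangle [simp]: "finite (index_triangle n)"
  by (rule finite_subset[of _ "{..2 * n} \<times> {..n}"]) (auto simp: index_triangle_def)

lemma index_triangle_0 [simp]: "index_triangle 0 = {}"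
  by (auto simp: index_triangle_def)

lemma index_triangle_Suc:
  "index_triangle (Suc n) =
     (\<lambda>i. (i, 0)) ` {..<2 * Suc n} \<union> map_prod Suc Suc ` index_triangle n"
proof (intro equalityI subsetI)
  fix p assume "p \<in> index_triangle (Suc n)"
  moreover obtain i j where "p = (i, j)" by (cases p)
  ultimately have ij: "j < Suc n" "j \<le> i" "i \<le> 2 * Suc n - 1 - j" "p = (i, j)"
    by (auto simp: index_triangle_def)
  show "p \<in> (\<lambda>i. (i, 0)) ` {..<2 * Suc n} \<union> map_prod Suc Suc ` index_triangle n"
  proof (cases j)
    case 0
    then show ?thesis using ij by auto
  next
    case (Suc j')
    then have "p = map_prod Suc Suc (i - 1, j')" "(i - 1, j') \<in> index_triangle n"
      using ij by (auto simp: index_triangle_def)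
    then show ?thesis by blast
  qed
qed (auto simp: index_triangle_def)

lemma index_triangle_layers_disjoint:
  "(\<lambda>i. (i, 0)) ` {..<m} \<inter> map_prod Suc Suc ` A = {}"
  by auto

lemma card_index_triangle: "card (index_triangle n) = n * (n + 1)"
proof (induction n)
  case (Suc n)
  have "card (index_triangle (Suc n)) =
      card ((\<lambda>i. (i, 0::nat)) ` {..<2 * Suc n}) + card (map_prod Suc Suc ` index_triangle n)"
    unfolding index_triangle_Suc
    by (rule card_Un_disjoint) (use index_triangle_layers_disjoint in auto)
  also have "\<dots> = 2 * Suc n + card (index_triangle n)"
    by (subst (1 2) card_image) (auto simp: inj_on_def)
  finally show ?case using Suc.IH by simp
qed simp

section \<open>The edges of the triangle\<close>

text \<open>
  A binary form in \<open>sin (u/2)\<close> and \<open>sin ((\<alpha> - u)/2)\<close> is determined by its values because the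
  ratio of these two functions is injective: equal ratios at \<open>u\<close> and \<open>u'\<close> give
  \<open>sin (\<alpha>/2) * sin ((u' - u)/2) = 0\<close> by the addition theorem.
\<close>

lemma binary_form_on_edge_zero:
  fixes \<alpha> :: real and e :: "nat \<Rightarrow> real"
  assumes \<alpha>: "0 < \<alpha>" "\<alpha> < pi"
    and zero: "\<And>u. 0 < u \<Longrightarrow> u < \<alpha> \<Longrightarrow>
      (\<Sum>i\<le>m. e i * (sin (u / 2) ^ (m - i) * sin ((\<alpha> - u) / 2) ^ i)) = 0"
    and k: "k \<le> m"
  shows "e k = 0"
proof -
  define t where "t u = sin ((\<alpha> - u) / 2) / sin (u / 2)" for u
  have pos: "sin (u / 2) > 0" if "0 < u" "u < \<alpha>" for u
    using that \<alpha> by (intro sin_gt_zero) auto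
  have inj: "inj_on t {0<..<\<alpha>}"
  proof (rule inj_onI)
    fix x y assume xy: "x \<in> {0<..<\<alpha>}" "y \<in> {0<..<\<alpha>}" "t x = t y"
    have nz: "sin (x / 2) \<noteq> 0" "sin (y / 2) \<noteq> 0"
      using pos[of x] pos[of y] xy(1,2) by auto
    have "sin ((\<alpha> - x) / 2) * sin (y / 2) = sin ((\<alpha> - y) / 2) * sin (x / 2)"
      using xy(3) nz by (simp add: t_def field_simps)
    moreover have "sin ((\<alpha> - x) / 2) * sin (y / 2) - sin ((\<alpha> - y) / 2) * sin (x / 2)
        = sin (\<alpha> / 2) * sin (y / 2 - x / 2)"
      by (simp add: diff_divide_distrib sin_diff algebra_simps)
    ultimately have "sin (\<alpha> / 2) * sin (y / 2 - x / 2) = 0" by simp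
    moreover have "sin (\<alpha> / 2) > 0" using \<alpha> by (intro sin_gt_zero) auto
    ultimately have "sin (y / 2 - x / 2) = 0" by simp
    moreover have "- pi < y / 2 - x / 2" "y / 2 - x / 2 < pi" using xy \<alpha> by auto
    ultimately show "x = y"
      using sin_eq_0_pi[of "y / 2 - x / 2"] by auto
  qed
  have root: "(\<Sum>i\<le>m. e i * t u ^ i) = 0" if u: "0 < u" "u < \<alpha>" for u
  proof -
    have "sin (u / 2) ^ m * (\<Sum>i\<le>m. e i * t u ^ i) =
        (\<Sum>i\<le>m. e i * (sin (u / 2) ^ (m - i) * sin ((\<alpha> - u) / 2) ^ i))"
      unfolding sum_distrib_left
    proof (rule sum.cong)
      fix i assume "i \<in> {..m}"
      then have "sin (u / 2) ^ m = sin (u / 2) ^ (m - i) * sin (u / 2) ^ i"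
        by (simp flip: power_add)
      then show "sin (u / 2) ^ m * (e i * t u ^ i) =
          e i * (sin (u / 2) ^ (m - i) * sin ((\<alpha> - u) / 2) ^ i)"
        using pos[OF u] by (simp add: t_def power_divide)
    qed simp
    then show ?thesis using zero[OF u] pos[OF u] by simp
  qed
  have "infinite (t ` {0<..<\<alpha>})"
    using \<alpha> inj by (simp add: finite_image_iff)
  moreover have "t ` {0<..<\<alpha>} \<subseteq> {x. (\<Sum>i\<le>m. e i * x ^ i) = 0}"
    using root by auto
  ultimately have "infinite {x. (\<Sum>i\<le>m. e i * x ^ i) = 0}"
    using finite_subset by blast
  then show ?thesis
    using polyfun_finite_roots[of e m] k by blast
qed

text \<open>
  A linear combination of the members of the joint system, with the coefficients of the three
  letters kept apart, so that a cyclic permutation of the variables amounts to a cyclic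
  permutation of \<open>a\<close>, \<open>b\<close>, \<open>c\<close>. The member with index \<open>(n, n)\<close> is the same for all three letters,
  and \<open>d\<close> is its coefficient.
\<close>

definition joint_sum ::
  "nat \<Rightarrow> (nat \<times> nat \<Rightarrow> real) \<Rightarrow> (nat \<times> nat \<Rightarrow> real) \<Rightarrow> (nat \<times> nat \<Rightarrow> real) \<Rightarrow> real
    \<Rightarrow> real \<Rightarrow> real \<Rightarrow> real \<Rightarrow> real" where
  "joint_sum n a b c d u v w =
     (\<Sum>(i, j)\<in>index_triangle n. a (i, j) * R_expr n i j u v w) +
     (\<Sum>(i, j)\<in>index_triangle n. b (i, j) * R_expr n i j w u v) +
     (\<Sum>(i, j)\<in>index_triangle n. c (i, j) * R_expr n i j v w u) +
     d * (sin (u / 2) * sin (v / 2) * sin (w / 2)) ^ n"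

lemma joint_sum_rotate: "joint_sum n a b c d u v w = joint_sum n b c a d w u v"
  by (simp add: joint_sum_def mult_ac)

lemma R_expr_first_eq_0:
  "i < 2 * n \<Longrightarrow> R_expr n i j 0 v w = 0"
  by (simp add: R_expr_def)

lemma R_expr_second_eq_0:
  "R_expr n i j u 0 w = (if j = 0 then sin (u / 2) ^ (2 * n - i) * sin (w / 2) ^ i else 0)"
  by (simp add: R_expr_def)

lemma R_expr_third_eq_0:
  "j \<le> i \<Longrightarrow> R_expr n i j u v 0 = (if i = 0 then sin (u / 2) ^ (2 * n) else 0)"
  by (auto simp: R_expr_def)

lemma joint_sum_on_edge:
  assumes "1 \<le> n"
  shows "joint_sum n a b c d u 0 w =
    (\<Sum>i\<le>2 * n. (if i < 2 * n then a (i, 0) else b (0, 0)) *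
       (sin (u / 2) ^ (2 * n - i) * sin (w / 2) ^ i))"
proof -
  let ?x = "sin (u / 2)" and ?z = "sin (w / 2)"
  have "(\<Sum>(i, j)\<in>index_triangle n. a (i, j) * R_expr n i j u 0 w) =
      (\<Sum>(i, j)\<in>(\<lambda>i. (i, 0)) ` {..<2 * n}. a (i, j) * R_expr n i j u 0 w)"
  proof (rule sum.mono_neutral_right)
    show "(\<lambda>i. (i, 0)) ` {..<2 * n} \<subseteq> index_triangle n"
      using assms by (auto simp: index_triangle_def)
    show "\<forall>p\<in>index_triangle n - (\<lambda>i. (i, 0)) ` {..<2 * n}.
        (case p of (i, j) \<Rightarrow> a (i, j) * R_expr n i j u 0 w) = 0"
      using assms by (auto simp: R_expr_second_eq_0 index_triangle_def)
  qed simp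
  also have "\<dots> = (\<Sum>i<2 * n. a (i, 0) * (?x ^ (2 * n - i) * ?z ^ i))"
    by (subst sum.reindex) (auto simp: inj_on_def R_expr_second_eq_0)
  finally have A: "(\<Sum>(i, j)\<in>index_triangle n. a (i, j) * R_expr n i j u 0 w) = \<dots>" .
  have "(\<Sum>(i, j)\<in>index_triangle n. b (i, j) * R_expr n i j w u 0) =
      (\<Sum>(i, j)\<in>{(0, 0)}. b (i, j) * R_expr n i j w u 0)"
  proof (rule sum.mono_neutral_right)
    show "{(0, 0)} \<subseteq> index_triangle n"
      using assms by (auto simp: index_triangle_def)
    show "\<forall>p\<in>index_triangle n - {(0, 0)}. (case p of (i, j) \<Rightarrow> b (i, j) * R_expr n i j w u 0) = 0"
      by (auto simp: R_expr_third_eq_0 index_triangle_def split: if_splits)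
  qed simp
  then have B: "(\<Sum>(i, j)\<in>index_triangle n. b (i, j) * R_expr n i j w u 0) = b (0, 0) * ?z ^ (2 * n)"
    by (simp add: R_expr_third_eq_0)
  have C: "(\<Sum>(i, j)\<in>index_triangle n. c (i, j) * R_expr n i j 0 w u) = 0"
    by (rule sum.neutral) (auto simp: R_expr_first_eq_0 index_triangle_def)
  show ?thesis
    unfolding joint_sum_def A B C using assms
    by (simp add: lessThan_Suc_atMost[symmetric])
qed

lemma continuous_R_expr:
  fixes S :: "real set"
  assumes "continuous_on S f" "continuous_on S g" "continuous_on S h"
  shows "continuous_on S (\<lambda>x. R_expr n i j (f x) (g x) (h x))"
  unfolding R_expr_def by (cases "i \<le> n") (auto intro!: continuous_intros assms)

lemma continuous_joint_sum:
  fixes S :: "real set"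
  assumes "continuous_on S f" "continuous_on S g" "continuous_on S h"
  shows "continuous_on S (\<lambda>x. joint_sum n a b c d (f x) (g x) (h x))"
  unfolding joint_sum_def case_prod_unfold
  by (intro continuous_intros continuous_R_expr assms) auto

definition vanishes_inside :: "real \<Rightarrow> (real \<Rightarrow> real \<Rightarrow> real \<Rightarrow> real) \<Rightarrow> bool" where
  "vanishes_inside \<alpha> f \<longleftrightarrow>
     (\<forall>u v w. 0 < u \<longrightarrow> 0 < v \<longrightarrow> 0 < w \<longrightarrow> u + v + w = \<alpha> \<longrightarrow> f u v w = 0)"

lemma vanishes_inside_rotate:
  assumes "vanishes_inside \<alpha> (joint_sum n a b c d)"
  shows "vanishes_inside \<alpha> (joint_sum n b c a d)"
  unfolding vanishes_inside_def
proof (intro allI impI)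
  fix u v w :: real
  assume "0 < u" "0 < v" "0 < w" "u + v + w = \<alpha>"
  then have "joint_sum n a b c d v w u = 0"
    using assms by (simp add: vanishes_inside_def)
  then show "joint_sum n b c a d u v w = 0"
    by (simp add: joint_sum_rotate[of n a])
qed

text \<open>
  The combination extends continuously to the edge \<open>v = 0\<close>, where it is a binary form of degree
  \<open>2n\<close>: the members \<open>R\<close> with \<open>j = 0\<close> supply all coefficients except that of the pure power of
  \<open>sin (w/2)\<close>, and \<open>(G, 0, 0)\<close> supplies this one.
\<close>

lemma edge_coefficients_zero:
  assumes \<alpha>: "0 < \<alpha>" "\<alpha> < pi" and n: "1 \<le> n"
    and van: "vanishes_inside \<alpha> (joint_sum n a b c d)" and i: "i < 2 * n"
  shows "a (i, 0) = 0"
proof -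
  have edge: "joint_sum n a b c d u 0 (\<alpha> - u) = 0" if u: "0 < u" "u < \<alpha>" for u
  proof -
    define h where "h v = joint_sum n a b c d u v (\<alpha> - u - v)" for v
    have cont: "continuous_on {0..\<alpha> - u} h"
      unfolding h_def by (intro continuous_joint_sum continuous_intros)
    have "h v = 0" if "v \<in> {0<..<\<alpha> - u}" for v
      using that u van by (simp add: h_def vanishes_inside_def)
    moreover have "closure {0<..<\<alpha> - u} = {0..\<alpha> - u}"
      using u by simp
    ultimately have "h 0 = 0"
      using continuous_constant_on_closure[where f = h and a = 0 and x = 0 and S = "{0<..<\<alpha> - u}"] cont u by simp
    then show ?thesis by (simp add: h_def)
  qed
  have "(if i < 2 * n then a (i, 0) else b (0, 0)) = 0"
    by (rule binary_form_on_edge_zero[OF \<alpha>, where m = "2 * n" and k = i])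
      (use i n edge in \<open>auto simp: joint_sum_on_edge\<close>)
  then show ?thesis using i by simp
qed

section \<open>Independence\<close>

text \<open>
  Raising \<open>n\<close>, \<open>i\<close>, \<open>j\<close> by one raises each exponent of a sine by one, leaves the exponent of the
  cosine unchanged, and preserves the case distinction \<open>i \<le> n\<close>.
\<close>

lemma R_expr_Suc_Suc:
  "R_expr (Suc n) (Suc i) (Suc j) u v w =
     sin (u / 2) * sin (v / 2) * sin (w / 2) * R_expr n i j u v w"
  if "i \<le> 2 * n"
proof -
  have "2 * Suc n - Suc i = Suc (2 * n - i)" using that by simp
  moreover have "2 * Suc n - Suc i - Suc j = 2 * n - i - j" by simp
  ultimately show ?thesis by (simp add: R_expr_def)
qed

lemma sum_peel_layer:
  assumes "\<forall>i < 2 * Suc n. a (i, 0) = 0"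
  shows "(\<Sum>(i, j)\<in>index_triangle (Suc n). a (i, j) * R_expr (Suc n) i j u v w) =
    sin (u / 2) * sin (v / 2) * sin (w / 2) *
      (\<Sum>(i, j)\<in>index_triangle n. a (Suc i, Suc j) * R_expr n i j u v w)"
proof -
  have "(\<Sum>(i, j)\<in>index_triangle (Suc n). a (i, j) * R_expr (Suc n) i j u v w) =
      (\<Sum>(i, j)\<in>map_prod Suc Suc ` index_triangle n. a (i, j) * R_expr (Suc n) i j u v w)"
    by (rule sum.mono_neutral_right) (use assms in \<open>auto simp: index_triangle_Suc\<close>)
  also have "\<dots> = (\<Sum>(i, j)\<in>index_triangle n. a (Suc i, Suc j) * R_expr (Suc n) (Suc i) (Suc j) u v w)"
    by (subst sum.reindex) (auto simp: inj_on_def case_prod_unfold map_prod_def)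
  also have "\<dots> = (\<Sum>(i, j)\<in>index_triangle n.
      sin (u / 2) * sin (v / 2) * sin (w / 2) * (a (Suc i, Suc j) * R_expr n i j u v w))"
    by (rule sum.cong) (auto simp: index_triangle_def R_expr_Suc_Suc)
  finally show ?thesis
    by (simp add: sum_distrib_left case_prod_unfold)
qed

text \<open>
  Vanishing is assumed on the open triangle only, because this is what survives the division by
  the product of the sines in the induction step.
\<close>

lemma coefficients_zero:
  assumes \<alpha>: "0 < \<alpha>" "\<alpha> < pi"
    and "vanishes_inside \<alpha> (joint_sum n a b c d)"
  shows "(\<forall>p\<in>index_triangle n. a p = 0 \<and> b p = 0 \<and> c p = 0) \<and> d = 0"
  using assms(3)
proof (induction n arbitrary: a b c)
  case 0
  have "joint_sum 0 a b c d (\<alpha> / 3) (\<alpha> / 3) (\<alpha> / 3) = 0"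
    using 0 \<alpha> by (simp add: vanishes_inside_def)
  then show ?case by (simp add: joint_sum_def)
next
  case (Suc n)
  note van = Suc.prems
  note van' = vanishes_inside_rotate[OF van]
  note van'' = vanishes_inside_rotate[OF van']
  have a0: "a (i, 0) = 0" and b0: "b (i, 0) = 0" and c0: "c (i, 0) = 0"
    if "i < 2 * Suc n" for i
    using edge_coefficients_zero[OF \<alpha> _ van that] edge_coefficients_zero[OF \<alpha> _ van' that]
      edge_coefficients_zero[OF \<alpha> _ van'' that] by simp_all
  let ?shift = "\<lambda>f. f \<circ> map_prod Suc Suc"
  have "vanishes_inside \<alpha> (joint_sum n (?shift a) (?shift b) (?shift c) d)"
    unfolding vanishes_inside_def
  proof (intro allI impI)
    fix u v w :: real
    assume uvw: "0 < u" "0 < v" "0 < w" "u + v + w = \<alpha>"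
    let ?s = "sin (u / 2) * sin (v / 2) * sin (w / 2)"
    have "sin (u / 2) > 0" "sin (v / 2) > 0" "sin (w / 2) > 0"
      using uvw \<alpha> by (auto intro!: sin_gt_zero)
    then have "?s \<noteq> 0" by simp
    moreover have "joint_sum (Suc n) a b c d u v w =
        ?s * joint_sum n (?shift a) (?shift b) (?shift c) d u v w"
      unfolding joint_sum_def
      using sum_peel_layer[of n a u v w] sum_peel_layer[of n b w u v] sum_peel_layer[of n c v w u]
        a0 b0 c0 by (simp add: ring_distribs mult_ac)
    moreover have "joint_sum (Suc n) a b c d u v w = 0"
      using van uvw by (simp add: vanishes_inside_def)
    ultimately show "joint_sum n (?shift a) (?shift b) (?shift c) d u v w = 0"
      by simp
  qed
  from Suc.IH[OF this] a0 b0 c0 show ?case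
    by (auto simp: index_triangle_Suc)
qed

text \<open>
  If two members with different indices were equal, their difference would be a vanishing
  combination with nonzero coefficients; so the hypothesis on coefficients also yields
  injectivity.
\<close>

lemma independent_familyI:
  assumes fin: "finite I"
    and zero: "\<And>c k. (\<Sum>k\<in>I. c k *\<^sub>R f k) = 0 \<Longrightarrow> k \<in> I \<Longrightarrow> c k = 0"
  shows "independent_family f I"
proof -
  have inj: "inj_on f I"
  proof (rule inj_onI, rule ccontr)
    fix k l assume kl: "k \<in> I" "l \<in> I" "f k = f l" "k \<noteq> l"
    let ?c = "\<lambda>m. (if m = k then 1 else 0) - (if m = l then 1 else 0) :: real"
    have "(\<Sum>m\<in>I. ?c m *\<^sub>R f m) =
        (\<Sum>m\<in>I. if m = k then f m else 0) - (\<Sum>m\<in>I. if m = l then f m else 0)"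
      unfolding sum_subtractf[symmetric] by (rule sum.cong) auto
    also have "\<dots> = 0" using kl fin by simp
    finally have "?c k = 0" using zero[of ?c k] kl by blast
    then show False using kl by simp
  qed
  have "independent (f ` I)"
  proof (rule independent_if_scalars_zero)
    fix c x assume "(\<Sum>x\<in>f ` I. c x *\<^sub>R x) = 0" "x \<in> f ` I"
    then show "c x = 0"
      using zero[of "c \<circ> f"] by (auto simp: sum.reindex[OF inj])
  qed (use fin in simp)
  with inj show ?thesis by (simp add: independent_family_def)
qed

section \<open>The joint system\<close>

lemma joint_index_eq:
  "joint_index n = Pair R ` index_triangle n \<union> Pair G ` index_triangle n \<union>
     Pair B ` index_triangle n \<union> {(R, n, n)}"
proof -
  have "l = R \<or> l = G \<or> l = B" for l by (cases l) auto
  then show ?thesis by (auto simp: joint_index_def index_triangle_def image_iff)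
qed

lemma sum_joint_index:
  fixes f :: "letter \<times> nat \<times> nat \<Rightarrow> 'a::comm_monoid_add"
  shows "(\<Sum>k\<in>joint_index n. f k) =
    (\<Sum>p\<in>index_triangle n. f (R, p)) + (\<Sum>p\<in>index_triangle n. f (G, p)) +
    (\<Sum>p\<in>index_triangle n. f (B, p)) + f (R, n, n)"
proof -
  have notin: "(n, n) \<notin> index_triangle n" by (simp add: index_triangle_def)
  have reindex: "(\<Sum>k\<in>Pair l ` index_triangle n. f k) = (\<Sum>p\<in>index_triangle n. f (l, p))" for l
    by (subst sum.reindex) (auto simp: inj_on_def)
  show ?thesis
    unfolding joint_index_eq
    by (subst sum.union_disjoint, (use notin in \<open>auto\<close>)[3])+ (simp add: reindex)
qed

lemma card_joint_index: "card (joint_index n) = 3 * n * (n + 1) + 1"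
  using sum_joint_index[of "\<lambda>_. 1::nat" n] by (simp add: card_index_triangle)

lemma sum_fun_apply:
  fixes F :: "'i \<Rightarrow> 'a \<Rightarrow> 'b::comm_monoid_add"
  shows "(\<Sum>k\<in>K. F k) x = (\<Sum>k\<in>K. F k x)"
  by (induction K rule: infinite_finite_induct) auto

lemma joint_fun_sum_eq_joint_sum:
  assumes "(u, v, w) \<in> Omega \<alpha>"
  shows "(\<Sum>k\<in>joint_index n. c k *\<^sub>R joint_fun \<alpha> n k) (u, v, w) =
    joint_sum n (\<lambda>p. c (R, p)) (\<lambda>p. c (G, p)) (\<lambda>p. c (B, p)) (c (R, n, n)) u v w"
proof -
  have member:
    "joint_fun \<alpha> n (R, p) (u, v, w) = R_expr n (fst p) (snd p) u v w"
    "joint_fun \<alpha> n (G, p) (u, v, w) = R_expr n (fst p) (snd p) w u v"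
    "joint_fun \<alpha> n (B, p) (u, v, w) = R_expr n (fst p) (snd p) v w u" for p
    using assms by (cases p; simp add: on_Omega_def)+
  have "R_expr n n n u v w = (sin (u / 2) * sin (v / 2) * sin (w / 2)) ^ n"
    by (simp add: R_expr_def power_mult_distrib)
  then show ?thesis
    using assms
    by (simp add: sum_fun_apply sum_joint_index joint_sum_def scaleR_fun_def case_prod_unfold
        member on_Omega_def)
qed

theorem theorem3p1:
  fixes \<alpha> :: real and n :: nat
  assumes "0 < \<alpha>" and "\<alpha> < pi" and "1 \<le> n"
  shows "independent_family (joint_fun \<alpha> n) (joint_index n) \<and>
         dim (span (joint_system \<alpha> n)) = 3 * n * (n + 1) + 1"
proof -
  have ind: "independent_family (joint_fun \<alpha> n) (joint_index n)"
  proof (rule independent_familyI)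
    fix c k
    assume zero: "(\<Sum>k\<in>joint_index n. c k *\<^sub>R joint_fun \<alpha> n k) = 0" and k: "k \<in> joint_index n"
    let ?s = "joint_sum n (\<lambda>p. c (R, p)) (\<lambda>p. c (G, p)) (\<lambda>p. c (B, p)) (c (R, n, n))"
    have "?s u v w = 0" if "0 < u" "0 < v" "0 < w" "u + v + w = \<alpha>" for u v w
    proof -
      have "(u, v, w) \<in> Omega \<alpha>" using that by (auto simp: Omega_def)
      from joint_fun_sum_eq_joint_sum[OF this, of c n] zero show ?thesis by simp
    qed
    then have "vanishes_inside \<alpha> ?s" by (simp add: vanishes_inside_def)
    from coefficients_zero[OF assms(1,2) this] k show "c k = 0"
      by (auto simp: joint_index_eq)
  qed (simp add: joint_index_eq)
  then have "dim (span (joint_system \<alpha> n)) = card (joint_index n)"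
    by (simp add: independent_family_def joint_system_def real_vector.dim_span
        real_vector.dim_eq_card_independent card_image)
  with ind show ?thesis by (simp add: card_joint_index)
qed

end
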